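(* Let $(L,[\cdot,\cdot])$ be a Lie algebra and let $\diamond:L\otimes L\to L$ be a bilinear operation with null curvature, $\mathbf{R}^{\diamond,[\cdot,\cdot]}\equiv 0$, and constant torsion, $\diamond\,\mathbf{T}^{\diamond,[\cdot,\cdot]}\equiv 0$. Then $(L,\diamond,-\mathbf{T}^{\diamond,[\cdot,\cdot]})=(L,\diamond,[\cdot,\cdot]-[\cdot,\cdot]_\diamond)$ is a post-Lie algebra.
   Context: Vector spaces are over $\mathbb{R}$. For a bilinear operation $\ast$ on a vector space $L$: $[x,y]_\ast:=x\ast y-y\ast x$ and $\mathsf{a}_\ast(x,y,z):=x\ast(y\ast z)-(x\ast y)\ast z$. A (left) post-Lie algebra $(L,\triangleright,[\cdot,\cdot])$ is a vector space with bilinear operations $\triangleright,[\cdot,\cdot]$ such that $[\cdot,\cdot]$ is a Lie bracket and, for all $x,y,z$: $x\triangleright[y,z]=[x\triangleright y,z]+[y,x\triangleright z]$ and $[x,y]\triangleright z=\mathsf{a}_\triangleright(x,y,z)-\mathsf{a}_\triangleright(y,x,z)$. For a bilinear operation $\diamond$ on a Lie algebra $(L,[\cdot,\cdot])$, the torsion and curvature are $\mathbf{T}^{\diamond,[\cdot,\cdot]}(x,y):=[x,y]_\diamond-[x,y]$ and $\mathbf{R}^{\diamond,[\cdot,\cdot]}(x,y,z):=x\diamond(y\diamond z)-y\diamond(x\diamond z)-[x,y]\diamond z$. For a bilinear map $\mathbf{T}:L\otimes L\to L$ the $\diamond$-covariant derivative is $(x\diamond\mathbf{T})(y,z):=x\diamond(\mathbf{T}(y,z))-\mathbf{T}(x\diamond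 y,z)-\mathbf{T}(y,x\diamond z)$; $\diamond\,\mathbf{T}\equiv0$ means $(x\diamond\mathbf{T})(y,z)=0$ for all $x,y,z\in L$. *)

theory Defs
  imports "HOL-Analysis.Linear_Algebra"
begin

text \<open>
  The underlying real vector space is a type of class \<^class>\<open>real_vector\<close>, of arbitrary
  dimension; operations on it are curried binary functions, and bilinearity is the library
  predicate \<^const>\<open>bilinear\<close>.
\<close>

definition commutator :: "('a::real_vector \<Rightarrow> 'a \<Rightarrow> 'a) \<Rightarrow> 'a \<Rightarrow> 'a \<Rightarrow> 'a" where
  "commutator m x y = m x y - m y x"

text \<open>The sign convention is opposite to the usual one \<open>(xy)z - x(yz)\<close>.\<close>

definition associator :: "('a::real_vector \<Rightarrow> 'a \<Rightarrow> 'a) \<Rightarrow> 'a \<Rightarrow> 'a \<Rightarrow> 'a \<Rightarrow> 'a" where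
  "associator m x y z = m x (m y z) - m (m x y) z"

definition lie_bracket :: "('a::real_vector \<Rightarrow> 'a \<Rightarrow> 'a) \<Rightarrow> bool" where
  "lie_bracket br \<longleftrightarrow>
     bilinear br \<and>
     (\<forall>x. br x x = 0) \<and>
     (\<forall>x y z. br x (br y z) + br y (br z x) + br z (br x y) = 0)"

definition post_lie_algebra ::
  "('a::real_vector \<Rightarrow> 'a \<Rightarrow> 'a) \<Rightarrow> ('a \<Rightarrow> 'a \<Rightarrow> 'a) \<Rightarrow> bool" where
  "post_lie_algebra tr br \<longleftrightarrow>
     bilinear tr \<and>
     lie_bracket br \<and>
     (\<forall>x y z. tr x (br y z) = br (tr x y) z + br y (tr x z)) \<and>
     (\<forall>x y z. tr (br x y) z = associator tr x y z - associator tr y x z)"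

definition torsion ::
  "('a::real_vector \<Rightarrow> 'a \<Rightarrow> 'a) \<Rightarrow> ('a \<Rightarrow> 'a \<Rightarrow> 'a) \<Rightarrow> 'a \<Rightarrow> 'a \<Rightarrow> 'a" where
  "torsion d br x y = commutator d x y - br x y"

definition curvature ::
  "('a::real_vector \<Rightarrow> 'a \<Rightarrow> 'a) \<Rightarrow> ('a \<Rightarrow> 'a \<Rightarrow> 'a) \<Rightarrow> 'a \<Rightarrow> 'a \<Rightarrow> 'a \<Rightarrow> 'a" where
  "curvature d br x y z = d x (d y z) - d y (d x z) - d (br x y) z"

definition covariant_derivative ::
  "('a::real_vector \<Rightarrow> 'a \<Rightarrow> 'a) \<Rightarrow> ('a \<Rightarrow> 'a \<Rightarrow> 'a) \<Rightarrow> 'a \<Rightarrow> 'a \<Rightarrow> 'a \<Rightarrow> 'a" where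
  "covariant_derivative d T x y z = d x (T y z) - T (d x y) z - T y (d x z)"

end

theory Submission
  imports Defs
begin

text \<open>
  Everything except the Jacobi identity of \<open>B = -T\<close> is a rewriting of the hypotheses. The Jacobi
  identity is the first Bianchi identity: since \<open>B\<close> is parallel, expanding the inner bracket of the
  cyclic sum of \<open>B x (B y z)\<close> turns it into the cyclic sum of \<open>B x [y, z] + d x (B y z)\<close>, which
  equals the cyclic sum of \<open>[x, [y, z]]\<close> minus the cyclic sum of the curvature.
\<close>

lemma bilinear_torsion:
  assumes "bilinear br" "bilinear d"
  shows "bilinear (torsion d br)"
  using assms
  by (auto simp: bilinear_def linear_iff torsion_def commutator_def algebra_simps)

text \<open>Polarisation: expand \<open>br (x + y) (x + y) = 0\<close>.\<close>

lemma lie_bracket_antisym: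
  assumes "lie_bracket br"
  shows "br x y = - br y x"
proof -
  have bl: "bilinear br" and alt: "\<And>x. br x x = 0"
    using assms by (auto simp: lie_bracket_def)
  have "br x y + br y x = br (x + y) (x + y) - br x x - br y y"
    by (simp add: bilinear_ladd[OF bl] bilinear_radd[OF bl])
  then show ?thesis
    by (simp add: alt eq_neg_iff_add_eq_0)
qed

lemma torsion_antisym:
  assumes "lie_bracket br"
  shows "torsion d br x y = - torsion d br y x"
  using lie_bracket_antisym[OF assms, of x y] by (simp add: torsion_def commutator_def)

lemma torsion_jacobi:
  assumes lie: "lie_bracket br"
    and d: "bilinear d"
    and flat: "\<And>x y z. curvature d br x y z = 0"
    and parallel: "\<And>x y z. covariant_derivative d (torsion d br) x y z = 0"
  shows "torsion d br x (torsion d br y z) + torsion d br y (torsion d br z x)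
    + torsion d br z (torsion d br x y) = 0"
proof -
  let ?T = "torsion d br"
  have br: "bilinear br"
    and jacobi: "br x (br y z) + br y (br z x) + br z (br x y) = 0"
    using lie by (auto simp: lie_bracket_def)
  note T = bilinear_torsion[OF br d]
  \<comment> \<open>The outer torsion stays folded, so that \<open>par\<close> can account for the
    terms in \<open>d\<close>.\<close>
  have inner: "?T u (?T v w) = ?T u (d v w) - ?T u (d w v) - ?T u (br v w)" for u v w
    by (simp add: torsion_def[of d br v w] commutator_def bilinear_rsub[OF T])
  \<comment> \<open>Antisymmetry moves \<open>d u v\<close> into the second slot, the shape of the
    terms in \<open>inner\<close>.\<close>
  have par: "d u (?T v w) = ?T v (d u w) - ?T w (d u v)" for u v w
    using parallel[of u v w] torsion_antisym[OF lie, of d w "d u v"]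
    by (simp add: covariant_derivative_def algebra_simps)
  \<comment> \<open>The two copies of \<open>d u (br v w)\<close> cancel, which leaves a double
    bracket and terms of curvature type.\<close>
  have outer: "d u (?T v w) + ?T u (br v w) =
      d u (d v w) - d u (d w v) - d (br v w) u - br u (br v w)" for u v w
    by (simp add: torsion_def commutator_def bilinear_radd[OF d] bilinear_rsub[OF d] algebra_simps)
  \<comment> \<open>By \<open>par\<close>, the terms \<open>?T u (d v w) - ?T u (d w v)\<close> sum
    cyclically to minus the cyclic sum of \<open>d u (?T v w)\<close>.\<close>
  have "?T x (?T y z) + ?T y (?T z x) + ?T z (?T x y) =
      - ((d x (?T y z) + ?T x (br y z)) + (d y (?T z x) + ?T y (br z x))
         + (d z (?T x y) + ?T z (br x y)))"
    unfolding inner[of x y z] inner[of y z x] inner[of z x y] par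
    by (simp add: algebra_simps)
  also have "\<dots> = (br x (br y z) + br y (br z x) + br z (br x y))
      - (curvature d br x y z + curvature d br y z x + curvature d br z x y)"
    unfolding outer curvature_def by (simp add: algebra_simps)
  also have "\<dots> = 0"
    by (simp add: jacobi flat)
  finally show ?thesis .
qed

theorem theorem2p5:
  fixes br d :: "'a::real_vector \<Rightarrow> 'a \<Rightarrow> 'a"
  assumes "lie_bracket br"
    and "bilinear d"
    and "\<forall>x y z. curvature d br x y z = 0"
    and "\<forall>x y z. covariant_derivative d (torsion d br) x y z = 0"
  shows "post_lie_algebra d (\<lambda>x y. - torsion d br x y) \<and>
         (\<lambda>x y. - torsion d br x y) = (\<lambda>x y. br x y - commutator d x y)"
proof
  let ?T = "torsion d br"
  have br: "bilinear br" and alt: "\<And>x. br x x = 0"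
    using assms(1) by (auto simp: lie_bracket_def)
  note d = assms(2)
  note T = bilinear_torsion[OF br d]
  have "bilinear (\<lambda>x y. - ?T x y)"
    using T by (auto simp: bilinear_def linear_iff)
  moreover have "- ?T x x = 0" for x
    by (simp add: torsion_def commutator_def alt)
  \<comment> \<open>Each term is quadratic in the bracket, so the signs cancel.\<close>
  moreover have "- ?T x (- ?T y z) + - ?T y (- ?T z x) + - ?T z (- ?T x y) = 0" for x y z
    using torsion_jacobi[OF assms(1) d, of x y z] assms(3,4)
    by (simp add: bilinear_rneg[OF T])
  ultimately have "lie_bracket (\<lambda>x y. - ?T x y)"
    by (simp add: lie_bracket_def)
  moreover have "d x (- ?T y z) = - ?T (d x y) z + - ?T y (d x z)" for x y z
    using assms(4)[rule_format, of x y z]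
    by (simp add: covariant_derivative_def bilinear_rneg[OF d] algebra_simps)
  \<comment> \<open>Flatness turns \<open>d (br x y) z\<close> into
    \<open>d x (d y z) - d y (d x z)\<close>; the commutator part of \<open>- ?T\<close> supplies
    the other halves of the associators.\<close>
  moreover have "d (- ?T x y) z = associator d x y z - associator d y x z" for x y z
    using assms(3)[rule_format, of x y z]
    by (simp add: curvature_def associator_def torsion_def commutator_def
        bilinear_ladd[OF d] bilinear_lsub[OF d] algebra_simps)
  ultimately show "post_lie_algebra d (\<lambda>x y. - ?T x y)"
    using d by (simp add: post_lie_algebra_def)
  show "(\<lambda>x y. - ?T x y) = (\<lambda>x y. br x y - commutator d x y)"
    by (simp add: torsion_def)
qed

end
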